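(* Let $q$ be a parameter with $-1<q\le 1$. Then the following hold. (i) For all integers $n\ge 0$, and $x^2\le 1$, $t^2<1$, $$\sum_{i\ge 0}\frac{t^{i}}{(q)_i}\,h_{i+n}(x|q)=h_n(x|t,q)\sum_{i\ge 0}\frac{t^{i}}{(q)_i}\,h_i(x|q),$$ where $h_n(x|t,q)$ is the big $q$-Hermite polynomial. (ii) For all integers $n\ge 0$, and $x^2\le 1$, $t^2<1$, $|at|<1$, $$\sum_{i\ge 0}\frac{t^{i}}{(q)_i}\,h_{i+n}(x|a,q)=\frac{Q_n(x|a,t,q)}{(at)_n}\sum_{i\ge 0}\frac{t^{i}}{(q)_i}\,h_i(x|a,q),$$ where $Q_n(x|a,t,q)$ is the Al-Salam--Chihara polynomial. (iii) For all integers $n\ge 0$, and $|x|\le 1$, $t^2<1$, $|at|<1$, $|bt|<1$, $$\sum_{i\ge 0}\frac{t^{i}}{(q)_i}\,Q_{i+n}(x|a,b,q)=\frac{\psi_n(x|a,b,t,q)}{(at,bt)_n}\sum_{i\ge 0}\frac{t^{i}}{(q)_i}\,Q_i(x|a,b,q),$$ where $\psi_n(x|a,b,t,q)$ is the continuous dual $q$-Hahn polynomial.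
   Context: Notation: for $n\ge 1$, $(\alpha)_n=(\alpha;q)_n=\prod_{j=0}^{n-1}(1-\alpha q^{j})$, with $(\alpha)_0=1$; $(\alpha_1,\alpha_2)_n=(\alpha_1)_n(\alpha_2)_n$; in particular $(q)_n=\prod_{j=1}^{n}(1-q^j)$. The polynomial families in $x$, with parameters $a,b,c$, are defined by the following three-term recurrences ($n\ge 0$). In each of them the polynomial with index $-1$ is $0$ and the polynomial with index $0$ is $1$. - $q$-Hermite: $h_{n+1}(x|q)=2x\,h_n(x|q)-(1-q^n)h_{n-1}(x|q)$. - Big $q$-Hermite: $h_{n+1}(x|a,q)=(2x-aq^n)h_n(x|a,q)-(1-q^n)h_{n-1}(x|a,q)$. - Al-Salam--Chihara: $Q_{n+1}(x|a,b,q)=(2x-(a+b)q^n)Q_n(x|a,b,q)-(1-abq^{n-1})(1-q^n)Q_{n-1}(x|a,b,q)$, where for $n=0$ the last term is set to $0$. - Continuous dual $q$-Hahn: $\psi_{n+1}(x|a,b,c,q)=(2x-d_n)\psi_n(x|a,b,c,q)-f_{n-1}(1-q^n)\psi_{n-1}(x|a,b,c,q)$, where $d_n=(a+b+c)q^n+abc\,q^{n-1}(1-q^n-q^{n+1})$ (so $d_0=a+b+c-abc$) and $f_n=(1-abq^n)(1-acq^n)(1-bcq^n)$. For $n=0$ the last term is set to $0$.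
   Formalization: At q = 1 the series are undefined since (q)_i = 0 for i ≥ 1; there each identity is read as: the quotient of the left series by the right series, taken at base p, tends to the stated factor at q = 1 as p → 1 from the left. *)

theory Defs
  imports "HOL-Analysis.Analysis"
begin

text \<open>
  \<open>qpoch \<alpha> q n\<close> is $(\alpha;q)_n$; in particular $(q)_n$ is \<open>qpoch q q n\<close>.
\<close>

definition qpoch :: "'a::comm_ring_1 \<Rightarrow> 'a \<Rightarrow> nat \<Rightarrow> 'a" where
  "qpoch \<alpha> q n = (\<Prod>j<n. 1 - \<alpha> * q ^ j)"

text \<open>
  The families are defined by their three-term recurrences over an arbitrary commutative ring.
  The second equation of each definition is the recurrence for $n = 0$, where the term of
  index $-1$ vanishes, and the third one is the recurrence for \<open>Suc n\<close>.
\<close>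

fun q_hermite :: "'a::comm_ring_1 \<Rightarrow> nat \<Rightarrow> 'a \<Rightarrow> 'a" where
  "q_hermite q 0 x = 1"
| "q_hermite q (Suc 0) x = 2 * x"
| "q_hermite q (Suc (Suc n)) x =
     2 * x * q_hermite q (Suc n) x - (1 - q ^ Suc n) * q_hermite q n x"

fun big_q_hermite :: "'a::comm_ring_1 \<Rightarrow> 'a \<Rightarrow> nat \<Rightarrow> 'a \<Rightarrow> 'a" where
  "big_q_hermite a q 0 x = 1"
| "big_q_hermite a q (Suc 0) x = 2 * x - a"
| "big_q_hermite a q (Suc (Suc n)) x =
     (2 * x - a * q ^ Suc n) * big_q_hermite a q (Suc n) x
       - (1 - q ^ Suc n) * big_q_hermite a q n x"

fun al_salam_chihara :: "'a::comm_ring_1 \<Rightarrow> 'a \<Rightarrow> 'a \<Rightarrow> nat \<Rightarrow> 'a \<Rightarrow> 'a" where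
  "al_salam_chihara a b q 0 x = 1"
| "al_salam_chihara a b q (Suc 0) x = 2 * x - (a + b)"
| "al_salam_chihara a b q (Suc (Suc n)) x =
     (2 * x - (a + b) * q ^ Suc n) * al_salam_chihara a b q (Suc n) x
       - (1 - a * b * q ^ n) * (1 - q ^ Suc n) * al_salam_chihara a b q n x"

text \<open>
  The coefficient $d_n$ contains $q^{n-1}$. For $n = 0$ the product
  $q^{-1}(1 - q^0 - q^1)$ is read as $-1$, also when $q = 0$.
\<close>

fun cdq_hahn_d :: "'a::comm_ring_1 \<Rightarrow> 'a \<Rightarrow> 'a \<Rightarrow> 'a \<Rightarrow> nat \<Rightarrow> 'a" where
  "cdq_hahn_d a b c q 0 = a + b + c - a * b * c"
| "cdq_hahn_d a b c q (Suc n) =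
     (a + b + c) * q ^ Suc n + a * b * c * q ^ n * (1 - q ^ Suc n - q ^ Suc (Suc n))"

definition cdq_hahn_f :: "'a::comm_ring_1 \<Rightarrow> 'a \<Rightarrow> 'a \<Rightarrow> 'a \<Rightarrow> nat \<Rightarrow> 'a" where
  "cdq_hahn_f a b c q n = (1 - a * b * q ^ n) * (1 - a * c * q ^ n) * (1 - b * c * q ^ n)"

fun cdq_hahn :: "'a::comm_ring_1 \<Rightarrow> 'a \<Rightarrow> 'a \<Rightarrow> 'a \<Rightarrow> nat \<Rightarrow> 'a \<Rightarrow> 'a" where
  "cdq_hahn a b c q 0 x = 1"
| "cdq_hahn a b c q (Suc 0) x = 2 * x - cdq_hahn_d a b c q 0"
| "cdq_hahn a b c q (Suc (Suc n)) x =
     (2 * x - cdq_hahn_d a b c q (Suc n)) * cdq_hahn a b c q (Suc n) x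
       - cdq_hahn_f a b c q n * (1 - q ^ Suc n) * cdq_hahn a b c q n x"

text \<open>
  \<open>q_series q t u\<close> is $\sum_i \frac{t^i}{(q)_i} u_i$. The coefficients are real; the sequence may
  take values in any real normed field (in particular in the complex numbers).
\<close>

definition q_series_term :: "real \<Rightarrow> real \<Rightarrow> (nat \<Rightarrow> 'a) \<Rightarrow> nat \<Rightarrow> 'a::real_normed_field" where
  "q_series_term q t u i = of_real (t ^ i / qpoch q q i) * u i"

definition q_series :: "real \<Rightarrow> real \<Rightarrow> (nat \<Rightarrow> 'a::real_normed_field) \<Rightarrow> 'a" where
  "q_series q t u = (\<Sum>i. q_series_term q t u i)"

text \<open>
  For $q = 1$ the denominators $(q)_i$ with $i > 0$ vanish, so an identity
  $\sum_i \frac{t^i}{(q)_i} u_{i+n} = r \sum_i \frac{t^i}{(q)_i} u_i$ is not defined there (and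
  division by zero being zero in HOL would give it an unintended meaning). At this endpoint the
  identity should be understood as the statement that the quotient of the two series tends to the
  factor \<open>r\<close> as the base tends to $1$ from the left; separately, the two series need not have
  finite limits.
\<close>

end

theory Submission
  imports Defs
begin

text \<open>
  Statements (i) and (ii) are the cases \<open>a = b = 0\<close> and \<open>b = 0\<close> of (iii). For (iii), write
  $F_n(t)$ for the series on the left. The factor $1 - q^i$ cancels against $(q)_i$, so
  $\sum_i \frac{t^i}{(q)_i} q^i Q_{i+n} = F_n(t) - t F_{n+1}(t)$, and applying this (twice for $q^{2i}$)
  to the three-term recurrence of the Al-Salam--Chihara polynomials yields a three-term
  recurrence of $F_n$ in \<open>n\<close>, which is that of $\psi_n / (at, bt)_n$.
\<close>

text \<open>The algebra is legitimate only once all series involved converge, including at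
  \<open>x = 1\<close> and \<open>x = -1\<close>. There the polynomials need not be bounded: for
  \<open>q = a = b = 0\<close> and \<open>x = 1\<close> the \<open>i\<close>-th one is
  \<open>i + 1\<close>. As \<open>q^i\<close> tends to 0, their recurrence is that of the Chebyshev
  polynomials up to a term of order \<open>q^i\<close>, so linear growth is the right target. It
  survives shifts, sums and bounded factors, hence every sequence summed below has it. The start
  \<open>n = 0\<close> needs its own argument, since the polynomial of index -1 would enter. It
  yields a relation between \<open>F 0\<close> and \<open>F 1\<close> alone, which also gives the
  q-difference equation behind the nonvanishing of the series. With that, the case
  \<open>q = 1\<close> requires no exchange of limit and sum: the quotient equals the explicit
  factor for all bases in (0,1).\<close>

section \<open>Chebyshev polynomials of the second kind on [-1,1]\<close>

text \<open>This is U of index \<open>n - 1\<close> at \<open>cos \<theta>\<close>, that is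
  \<open>sin (n \<theta>) / sin \<theta>\<close>. The recursion avoids the division, so that
  \<open>sin \<theta> = 0\<close> is covered.\<close>

primrec chebyshev_U :: "real \<Rightarrow> nat \<Rightarrow> real" where
  "chebyshev_U \<theta> 0 = 0"
| "chebyshev_U \<theta> (Suc n) = cos \<theta> * chebyshev_U \<theta> n + cos (real n * \<theta>)"

lemma chebyshev_U_sin: "sin \<theta> * chebyshev_U \<theta> n = sin (real n * \<theta>)"
proof (induction n)
  case (Suc n)
  have "sin \<theta> * chebyshev_U \<theta> (Suc n)
      = cos \<theta> * (sin \<theta> * chebyshev_U \<theta> n) + sin \<theta> * cos (real n * \<theta>)"
    by (simp add: algebra_simps)
  also have "\<dots> = sin (real (Suc n) * \<theta>)"
    unfolding Suc.IH by (simp add: algebra_simps sin_add)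
  finally show ?case .
qed simp

text \<open>Dividing the addition theorem by \<open>sin \<theta>\<close> would lose the endpoints.
  Instead \<open>sin (n \<theta>)\<close> is written as \<open>sin \<theta>\<close> times
  \<open>chebyshev_U\<close>, so only the square of \<open>sin \<theta>\<close> occurs.\<close>

lemma chebyshev_U_recurrence:
  "chebyshev_U \<theta> (Suc (Suc n)) = 2 * cos \<theta> * chebyshev_U \<theta> (Suc n) - chebyshev_U \<theta> n"
proof -
  have "cos (real (Suc n) * \<theta>)
      = cos \<theta> * cos (real n * \<theta>) - sin \<theta> * (sin \<theta> * chebyshev_U \<theta> n)"
    unfolding chebyshev_U_sin by (simp add: algebra_simps cos_add)
  also have "sin \<theta> * (sin \<theta> * chebyshev_U \<theta> n) = (1 - (cos \<theta>)\<^sup>2) * chebyshev_U \<theta> n"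
    by (simp flip: sin_squared_eq) (simp add: power2_eq_square)
  finally show ?thesis
    by (simp add: algebra_simps power2_eq_square)
qed

lemma abs_chebyshev_U_le: "\<bar>chebyshev_U \<theta> n\<bar> \<le> real n"
proof (induction n)
  case (Suc n)
  have "\<bar>cos \<theta> * chebyshev_U \<theta> n\<bar> \<le> 1 * real n"
    unfolding abs_mult by (intro mult_mono Suc.IH) auto
  moreover have "\<bar>cos (real n * \<theta>)\<bar> \<le> 1"
    by simp
  ultimately show ?case
    unfolding chebyshev_U.simps by linarith
qed simp

section \<open>Linear growth of the polynomials in the index\<close>

definition linearly_bounded :: "(nat \<Rightarrow> 'a::real_normed_vector) \<Rightarrow> bool" where
  "linearly_bounded u \<longleftrightarrow> (\<exists>C. \<forall>n. norm (u n) \<le> C * real (Suc n))"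

lemma linearly_boundedE:
  assumes "linearly_bounded u"
  obtains C where "C \<ge> 0" "\<And>n. norm (u n) \<le> C * real (Suc n)"
proof -
  obtain C where C: "\<And>n. norm (u n) \<le> C * real (Suc n)"
    using assms unfolding linearly_bounded_def by blast
  have "0 \<le> C * real (Suc 0)"
    using norm_ge_zero C by (rule order_trans)
  with C that show ?thesis by simp
qed

lemma linearly_bounded_Suc:
  assumes "linearly_bounded u"
  shows "linearly_bounded (\<lambda>i. u (Suc i))"
proof -
  obtain C where C: "C \<ge> 0" "\<And>n. norm (u n) \<le> C * real (Suc n)"
    using assms by (elim linearly_boundedE) blast
  have "norm (u (Suc n)) \<le> 2 * C * real (Suc n)" for n
  proof -
    have "C * real (Suc (Suc n)) \<le> C * (2 * real (Suc n))"
      using C(1) by (intro mult_left_mono) auto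
    with C(2)[of "Suc n"] show ?thesis by (simp add: algebra_simps)
  qed
  then show ?thesis unfolding linearly_bounded_def by blast
qed

lemma linearly_bounded_offset:
  assumes "linearly_bounded u"
  shows "linearly_bounded (\<lambda>i. u (i + n))"
proof (induction n)
  case (Suc n)
  from linearly_bounded_Suc[OF this] show ?case by simp
qed (use assms in simp)

lemma linearly_bounded_add:
  assumes "linearly_bounded u" "linearly_bounded v"
  shows "linearly_bounded (\<lambda>i. u i + v i)"
proof -
  obtain C D where "\<And>n. norm (u n) \<le> C * real (Suc n)" "\<And>n. norm (v n) \<le> D * real (Suc n)"
    using assms unfolding linearly_bounded_def by blast
  then have "norm (u n + v n) \<le> (C + D) * real (Suc n)" for n
    unfolding distrib_right by (intro norm_triangle_mono)
  then show ?thesis unfolding linearly_bounded_def by blast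
qed

lemma linearly_bounded_mult:
  fixes u :: "nat \<Rightarrow> 'a::real_normed_field"
  assumes "linearly_bounded u" "\<And>i. norm (c i) \<le> B"
  shows "linearly_bounded (\<lambda>i. c i * u i)"
proof -
  obtain C where C: "C \<ge> 0" "\<And>n. norm (u n) \<le> C * real (Suc n)"
    using assms(1) by (elim linearly_boundedE) blast
  have "norm (c n * u n) \<le> (B * C) * real (Suc n)" for n
    unfolding norm_mult mult.assoc
    using order_trans[OF norm_ge_zero assms(2)] by (intro mult_mono assms(2) C(2)) auto
  then show ?thesis unfolding linearly_bounded_def by blast
qed

lemma linearly_bounded_power_mult:
  fixes u :: "nat \<Rightarrow> 'a::real_normed_field"
  assumes "linearly_bounded u" "norm c \<le> 1"
  shows "linearly_bounded (\<lambda>i. c ^ i * u i)"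
  using assms(1) by (rule linearly_bounded_mult[where B = 1])
    (use assms(2) in \<open>simp add: norm_power power_le_one\<close>)

lemma norm_one_minus_power_le:
  fixes c :: "'a::real_normed_div_algebra"
  assumes "norm c \<le> 1"
  shows "norm (1 - c ^ i) \<le> 2"
  using norm_triangle_ineq4[of 1 "c ^ i"] power_le_one[OF norm_ge_zero assms, of i]
  by (simp add: norm_power)

text \<open>
  A geometrically small perturbation of the Chebyshev recurrence keeps the linear growth of its
  solutions. For fixed \<open>N\<close> the combination
  \<open>chebyshev_U (N - k + 1) u\<^bsub>k+1\<^esub> - chebyshev_U (N - k) u\<^sub>k\<close> is constant in \<open>k\<close> for the
  unperturbed recurrence and equals \<open>u\<^bsub>N+1\<^esub>\<close> at \<open>k = N\<close>; a discrete Gronwall argument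
  controls its variation.
\<close>

lemma linearly_bounded_perturbed_recurrence:
  fixes u :: "nat \<Rightarrow> 'a::real_normed_vector"
  assumes x: "\<bar>x\<bar> \<le> 1" and r: "0 \<le> r" "r < 1" and D: "0 \<le> D"
    and e: "\<And>n. norm (u (Suc (Suc n)) - (2 * x) *\<^sub>R u (Suc n) + u n)
              \<le> D * r ^ n * (norm (u (Suc n)) + norm (u n))"
  shows "linearly_bounded u"
proof -
  define \<theta> where "\<theta> = arccos x"
  have x_cos: "x = cos \<theta>"
    using x unfolding \<theta>_def by (simp add: abs_le_iff)
  define V where "V = chebyshev_U \<theta>"
  define \<epsilon> where "\<epsilon> n = u (Suc (Suc n)) - (2 * x) *\<^sub>R u (Suc n) + u n" for n
  define K where "K = norm (u 0) + norm (u 1)"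
  define S where "S n = K + (\<Sum>k<n. norm (\<epsilon> k))" for n
  have V_rec: "V (Suc (Suc n)) = 2 * x * V (Suc n) - V n" for n
    unfolding V_def x_cos by (rule chebyshev_U_recurrence)
  have V_le: "\<bar>V n\<bar> \<le> real n" for n
    unfolding V_def by (rule abs_chebyshev_U_le)
  have S_mono: "S n \<le> S (Suc n)" for n
    unfolding S_def by simp
  have S_nonneg: "0 \<le> S n" for n
    unfolding S_def K_def by (intro add_nonneg_nonneg sum_nonneg) auto
  \<comment> \<open>The bound for index \<open>N + 1\<close> involves only the perturbations before
    \<open>N\<close>. This lets \<open>\<epsilon> n\<close>, which depends on \<open>u\<close> up to
    index \<open>n + 1\<close>, be estimated by \<open>S n\<close>, so that the recursion for
    \<open>S\<close> closes.\<close>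
  have step: "norm (u (Suc N)) \<le> real (Suc N) * S N" for N
  proof -
    define P where "P k = V (Suc (N - k)) *\<^sub>R u (Suc k) - V (N - k) *\<^sub>R u k" for k
    have P: "norm (P k) \<le> real (Suc N) * S k" if "k \<le> N" for k
      using that
    proof (induction k)
      case 0
      have "norm (P 0) \<le> real (Suc N) * norm (u 1) + real (Suc N) * norm (u 0)"
        unfolding P_def norm_scaleR using V_le[of "Suc N"] V_le[of N]
        by (intro order_trans[OF norm_triangle_ineq4] add_mono)
          (auto intro!: mult_right_mono simp: norm_scaleR)
      then show ?case unfolding S_def K_def by (simp add: algebra_simps)
    next
      case (Suc k)
      then have "k < N" by simp
      then have Nk: "N - k = Suc (N - Suc k)" by simp
      have "P (Suc k) = P k + V (N - k) *\<^sub>R \<epsilon> k"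
        unfolding P_def \<epsilon>_def Nk V_rec by (simp add: algebra_simps)
      then have "norm (P (Suc k)) \<le> norm (P k) + \<bar>V (N - k)\<bar> * norm (\<epsilon> k)"
        using norm_triangle_ineq[of "P k" "V (N - k) *\<^sub>R \<epsilon> k"] by simp
      also have "\<dots> \<le> real (Suc N) * S k + real (Suc N) * norm (\<epsilon> k)"
        using V_le[of "N - k"] Suc by (intro add_mono mult_right_mono) auto
      finally show ?case unfolding S_def by (simp add: algebra_simps)
    qed
    have "P N = u (Suc N)"
      unfolding P_def V_def by simp
    with P[of N] show ?thesis by simp
  qed
  have u_le: "norm (u n) \<le> real (Suc n) * S n" for n
  proof (cases n)
    case 0
    then show ?thesis by (simp add: S_def K_def)
  next
    case (Suc m)
    have "real (Suc m) * S m \<le> real (Suc n) * S n"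
      using S_mono[of m] S_nonneg Suc by (intro mult_mono) auto
    with step[of m] Suc show ?thesis by simp
  qed
  \<comment> \<open>Both norms in the hypothesis are at most \<open>(n + 1) * S n\<close>; the
    constant 3 is a roomy bound for their number 2. The linear weight is harmless against
    \<open>r ^ n\<close>.\<close>
  define \<delta> where "\<delta> n = 3 * D * (real (Suc n) * r ^ n)" for n
  have S_step: "S (Suc n) \<le> S n * exp (\<delta> n)" for n
  proof -
    have "norm (u (Suc n)) + norm (u n) \<le> 3 * real (Suc n) * S n"
      using u_le[of n] step[of n] mult_nonneg_nonneg[OF of_nat_0_le_iff S_nonneg[of n]]
      unfolding mult.assoc by (smt (verit))
    then have "norm (\<epsilon> n) \<le> D * r ^ n * (3 * real (Suc n) * S n)"
      unfolding \<epsilon>_def using D r by (intro order_trans[OF e] mult_left_mono) auto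
    then have "S (Suc n) \<le> S n * (1 + \<delta> n)"
      unfolding S_def \<delta>_def by (simp add: algebra_simps)
    also have "\<dots> \<le> S n * exp (\<delta> n)"
      by (intro mult_left_mono exp_ge_add_one_self S_nonneg)
    finally show ?thesis .
  qed
  have S_le: "S n \<le> K * exp (\<Sum>k<n. \<delta> k)" for n
  proof (induction n)
    case (Suc n)
    have "S (Suc n) \<le> (K * exp (\<Sum>k<n. \<delta> k)) * exp (\<delta> n)"
      by (intro order_trans[OF S_step] mult_right_mono Suc.IH) simp
    then show ?case by (simp add: exp_add mult.assoc)
  qed (simp add: S_def)
  have "summable \<delta>"
    unfolding \<delta>_def using r
    by (intro summable_mult sums_summable[OF geometric_deriv_sums]) simp
  then have \<delta>_sum: "(\<Sum>k<n. \<delta> k) \<le> suminf \<delta>" for n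
    by (rule sum_le_suminf) (use D r in \<open>auto simp: \<delta>_def\<close>)
  have "S n \<le> K * exp (suminf \<delta>)" for n
    by (intro order_trans[OF S_le] mult_left_mono) (use \<delta>_sum in \<open>auto simp: K_def\<close>)
  then have "norm (u n) \<le> (K * exp (suminf \<delta>)) * real (Suc n)" for n
    using order_trans[OF u_le mult_left_mono[OF _ of_nat_0_le_iff]] by (metis mult.commute)
  then show ?thesis unfolding linearly_bounded_def by blast
qed

text \<open>Expanding \<open>(1 - a b q^n) (1 - q^(n+1))\<close> leaves 1 plus terms divisible by
  \<open>q^n\<close>, and so does the coefficient of the middle term relative to \<open>2 x\<close>.
  Hence the perturbation lemma applies with ratio \<open>\<bar>q\<bar>\<close>.\<close>

lemma linearly_bounded_al_salam_chihara:
  fixes a b :: "'a::real_normed_field"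
  assumes x: "\<bar>x\<bar> \<le> 1" and q: "\<bar>q\<bar> < 1"
  shows "linearly_bounded (\<lambda>i. al_salam_chihara a b (of_real q) i (of_real x))"
proof (rule linearly_bounded_perturbed_recurrence[OF x, of "\<bar>q\<bar>"])
  let ?Q = "\<lambda>i. al_salam_chihara a b (of_real q) i (of_real x)"
  \<comment> \<open>One constant for both coefficients: \<open>norm a + norm b\<close> covers the
    one of \<open>?Q (Suc n)\<close>, the rest the one of \<open>?Q n\<close>.\<close>
  let ?D = "norm a + norm b + 1 + 2 * (norm a * norm b)"
  fix n
  let ?q = "of_real q :: 'a"
  have eq: "?Q (Suc (Suc n)) - (2 * x) *\<^sub>R ?Q (Suc n) + ?Q n
      = ?q ^ n * (a * b + ?q - a * b * ?q ^ Suc n) * ?Q n - ?q ^ n * ((a + b) * ?q) * ?Q (Suc n)"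
    by (simp add: scaleR_conv_of_real algebra_simps)
  have pow: "\<bar>q\<bar> ^ k \<le> 1" for k
    using q by (intro power_le_one) auto
  have "norm (a * b + ?q - a * b * ?q ^ Suc n) \<le> norm (a * b) + norm ?q + norm (a * b * ?q ^ Suc n)"
    by (intro order_trans[OF norm_triangle_ineq4] add_mono norm_triangle_ineq order_refl)
  also have "\<dots> \<le> norm a * norm b + 1 + norm a * norm b * 1"
    unfolding norm_mult norm_power norm_of_real using q pow
    by (intro add_mono mult_left_mono) (auto simp del: power_Suc)
  also have "\<dots> \<le> ?D" by simp
  finally have c0: "norm (a * b + ?q - a * b * ?q ^ Suc n) \<le> ?D" .
  have "norm ((a + b) * ?q) \<le> (norm a + norm b) * 1"
    unfolding norm_mult norm_of_real using q by (intro mult_mono norm_triangle_ineq) auto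
  also have "\<dots> \<le> ?D" by simp
  finally have c1: "norm ((a + b) * ?q) \<le> ?D" .
  have "norm (?Q (Suc (Suc n)) - (2 * x) *\<^sub>R ?Q (Suc n) + ?Q n)
      \<le> norm (?q ^ n * (a * b + ?q - a * b * ?q ^ Suc n) * ?Q n)
         + norm (?q ^ n * ((a + b) * ?q) * ?Q (Suc n))"
    unfolding eq by (rule norm_triangle_ineq4)
  also have "\<dots> \<le> \<bar>q\<bar> ^ n * ?D * norm (?Q n) + \<bar>q\<bar> ^ n * ?D * norm (?Q (Suc n))"
    unfolding norm_mult[of _ "?Q _"] norm_mult[of "?q ^ n"] norm_power norm_of_real
    by (intro add_mono mult_right_mono mult_left_mono c0 c1) auto
  finally show "norm (?Q (Suc (Suc n)) - (2 * x) *\<^sub>R ?Q (Suc n) + ?Q n)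
      \<le> ?D * \<bar>q\<bar> ^ n * (norm (?Q (Suc n)) + norm (?Q n))"
    by (simp add: algebra_simps)
qed (use q in auto)

section \<open>Convergence of the series and multiplication of terms by powers of the base\<close>

lemma qpoch_Suc: "qpoch \<alpha> q (Suc n) = qpoch \<alpha> q n * (1 - \<alpha> * q ^ n)"
  by (simp add: qpoch_def)

lemma one_minus_mult_power_nonzero:
  fixes \<alpha> q :: "'a::real_normed_field"
  assumes "norm \<alpha> < 1" "norm q \<le> 1"
  shows "1 - \<alpha> * q ^ n \<noteq> 0"
proof
  assume "1 - \<alpha> * q ^ n = 0"
  then have "norm (\<alpha> * q ^ n) = 1" by (metis eq_iff_diff_eq_0 norm_one)
  moreover have "norm (\<alpha> * q ^ n) \<le> norm \<alpha> * 1"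
    unfolding norm_mult norm_power using assms by (intro mult_left_mono power_le_one) auto
  ultimately show False using assms by simp
qed

lemma qpoch_nonzero:
  fixes \<alpha> q :: "'a::real_normed_field"
  assumes "norm \<alpha> < 1" "norm q \<le> 1"
  shows "qpoch \<alpha> q n \<noteq> 0"
  unfolding qpoch_def using one_minus_mult_power_nonzero[OF assms] by simp

text \<open>The majorant \<open>(n + 1) t^n / (q)_n\<close> has term ratio tending to
  \<open>\<bar>t\<bar>\<close> in absolute value, because \<open>q^n\<close> tends to 0; it drops
  below some \<open>c < 1\<close> only eventually.\<close>

lemma summable_q_series_term:
  fixes u :: "nat \<Rightarrow> 'a::{real_normed_field, banach}"
  assumes u: "linearly_bounded u" and q: "\<bar>q\<bar> < 1" and t: "\<bar>t\<bar> < 1"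
  shows "summable (q_series_term q t u)"
proof -
  obtain C where C: "\<And>n. norm (u n) \<le> C * real (Suc n)"
    using u unfolding linearly_bounded_def by blast
  define w where "w n = t ^ n / qpoch q q n * real (Suc n)" for n
  have nz: "qpoch q q n \<noteq> 0" for n
    using q by (intro qpoch_nonzero) auto
  have w_Suc: "w (Suc n) = (t / (1 - q ^ Suc n) * (real (Suc (Suc n)) / real (Suc n))) * w n" for n
    unfolding w_def qpoch_Suc by (simp add: mult_ac del: of_nat_Suc)
  obtain c where c: "\<bar>t\<bar> < c" "c < 1"
    using dense[OF t] by blast
  have qn: "(\<lambda>n. q ^ Suc n) \<longlonglongrightarrow> 0"
    using LIMSEQ_power_zero[of q] q by (simp add: filterlim_sequentially_Suc del: power_Suc)
  have "(\<lambda>n. real (Suc (Suc n)) / real (Suc n)) \<longlonglongrightarrow> 1"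
    using filterlim_compose[OF LIMSEQ_Suc_n_over_n filterlim_Suc] by simp
  then have "(\<lambda>n. \<bar>t / (1 - q ^ Suc n) * (real (Suc (Suc n)) / real (Suc n))\<bar>)
      \<longlonglongrightarrow> \<bar>t / (1 - 0) * 1\<bar>"
    by (intro tendsto_rabs tendsto_mult tendsto_divide tendsto_const tendsto_diff qn) auto
  then have "\<forall>\<^sub>F n in sequentially.
      \<bar>t / (1 - q ^ Suc n) * (real (Suc (Suc n)) / real (Suc n))\<bar> < c"
    by (rule order_tendstoD) (use c in simp)
  then obtain N where N: "\<And>n. n \<ge> N \<Longrightarrow>
      \<bar>t / (1 - q ^ Suc n) * (real (Suc (Suc n)) / real (Suc n))\<bar> < c"
    unfolding eventually_sequentially by blast
  have "summable (\<lambda>n. norm (w n))"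
  proof (rule summable_ratio_test[OF c(2)])
    fix n assume "n \<ge> N"
    then show "norm (norm (w (Suc n))) \<le> c * norm (norm (w n))"
      unfolding w_Suc real_norm_def abs_idempotent
      by (subst abs_mult, intro mult_right_mono less_imp_le[OF N]) auto
  qed
  then have "summable (\<lambda>n. C * norm (w n))"
    by (rule summable_mult)
  then show ?thesis
  proof (rule summable_comparison_test'[where N = 0])
    fix n
    have "norm (q_series_term q t u n) \<le> \<bar>t ^ n / qpoch q q n\<bar> * (C * real (Suc n))"
      unfolding q_series_term_def norm_mult norm_of_real by (intro mult_left_mono C) simp
    then show "norm (q_series_term q t u n) \<le> C * norm (w n)"
      unfolding w_def real_norm_def abs_mult[of _ "real (Suc n)"] abs_of_nat by (simp only: mult_ac)
  qed
qed

lemma q_series_add: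
  fixes u v :: "nat \<Rightarrow> 'a::{real_normed_field, banach}"
  assumes "\<bar>q\<bar> < 1" "\<bar>t\<bar> < 1" "linearly_bounded u" "linearly_bounded v"
  shows "q_series q t (\<lambda>i. u i + v i) = q_series q t u + q_series q t v"
  using suminf_add[OF summable_q_series_term[OF assms(3,1,2)] summable_q_series_term[OF assms(4,1,2)]]
  unfolding q_series_def q_series_term_def by (simp add: distrib_left)

lemma q_series_cmult:
  fixes u :: "nat \<Rightarrow> 'a::{real_normed_field, banach}"
  assumes "\<bar>q\<bar> < 1" "\<bar>t\<bar> < 1" "linearly_bounded u"
  shows "q_series q t (\<lambda>i. c * u i) = c * q_series q t u"
  using suminf_mult[OF summable_q_series_term[OF assms(3,1,2)], of c]
  unfolding q_series_def q_series_term_def by (simp add: mult.left_commute)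

text \<open>The factor $1 - q^i$ turns $(q)_i$ into $(q)_{i-1}$.\<close>

lemma q_series_one_minus_power:
  fixes u :: "nat \<Rightarrow> 'a::{real_normed_field, banach}"
  assumes q: "\<bar>q\<bar> < 1" and t: "\<bar>t\<bar> < 1" and u: "linearly_bounded u"
  shows "q_series q t (\<lambda>i. (1 - of_real q ^ i) * u i) = of_real t * q_series q t (\<lambda>i. u (Suc i))"
proof -
  let ?v = "\<lambda>i. (1 - of_real q ^ i) * u i"
  have "linearly_bounded ?v"
    using q by (intro linearly_bounded_mult[OF u, of _ 2] norm_one_minus_power_le) simp
  then have "summable (q_series_term q t ?v)"
    by (rule summable_q_series_term[OF _ q t])
  note split = suminf_split_head[OF this]
  have term_Suc: "q_series_term q t ?v (Suc i) = of_real t * q_series_term q t (\<lambda>i. u (Suc i)) i" for i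
  proof -
    have "1 - q * q ^ i \<noteq> 0"
      using q by (intro one_minus_mult_power_nonzero) auto
    then have "t ^ Suc i / qpoch q q (Suc i) * (1 - q ^ Suc i) = t * (t ^ i / qpoch q q i)"
      unfolding qpoch_Suc by simp
    then have "of_real (t ^ Suc i / qpoch q q (Suc i)) * (1 - of_real q ^ Suc i)
        = (of_real t * of_real (t ^ i / qpoch q q i) :: 'a)"
      by (metis of_real_1 of_real_diff of_real_mult of_real_power)
    then show ?thesis unfolding q_series_term_def by (simp add: mult.assoc[symmetric])
  qed
  \<comment> \<open>The head term vanishes because \<open>1 - q^0 = 0\<close>, so the index shift
    loses nothing.\<close>
  from split have "q_series q t ?v = (\<Sum>i. q_series_term q t ?v (Suc i))"
    unfolding q_series_def by (simp add: q_series_term_def[of _ _ _ 0])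
  also have "\<dots> = (\<Sum>i. of_real t * q_series_term q t (\<lambda>i. u (Suc i)) i)"
    unfolding term_Suc ..
  also have "\<dots> = of_real t * q_series q t (\<lambda>i. u (Suc i))"
    unfolding q_series_def
    by (intro suminf_mult summable_q_series_term linearly_bounded_Suc u q t)
  finally show ?thesis .
qed

text \<open>Write \<open>q^i\<close> as \<open>1 - (1 - q^i)\<close>. Recurrence coefficients that
  are polynomial in \<open>q^i\<close> thereby become combinations of index shifts.\<close>

lemma q_series_power_mult:
  fixes u :: "nat \<Rightarrow> 'a::{real_normed_field, banach}"
  assumes q: "\<bar>q\<bar> < 1" and t: "\<bar>t\<bar> < 1" and u: "linearly_bounded u"
  shows "q_series q t (\<lambda>i. of_real q ^ i * u i)
    = q_series q t u - of_real t * q_series q t (\<lambda>i. u (Suc i))"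
proof -
  have W: "linearly_bounded (\<lambda>i. of_real q ^ i * u i)"
    using q by (intro linearly_bounded_power_mult u) simp
  have "q_series q t (\<lambda>i. u i + (-1) * (of_real q ^ i * u i))
      = q_series q t u + (-1) * q_series q t (\<lambda>i. of_real q ^ i * u i)"
    by (subst q_series_add[OF q t u], rule linearly_bounded_mult[OF W, of _ 1], simp)
      (simp only: q_series_cmult[OF q t W])
  with q_series_one_minus_power[OF assms] show ?thesis
    by (simp add: algebra_simps)
qed

text \<open>Together with the previous lemma this expresses the series at \<open>q t\<close> by
  series at \<open>t\<close>, the source of the q-difference equation used for nonvanishing.\<close>

lemma q_series_base_mult:
  "q_series q (q * t) u = q_series q t (\<lambda>i. of_real q ^ i * u i)"
  unfolding q_series_def q_series_term_def
  by (simp add: power_mult_distrib mult_ac)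

lemma summable_al_salam_chihara:
  fixes a b :: "'a::{real_normed_field, banach}"
  assumes "\<bar>q\<bar> < 1" "\<bar>x\<bar> \<le> 1" "\<bar>t\<bar> < 1"
  shows "summable (q_series_term q t (\<lambda>i. al_salam_chihara a b (of_real q) (i + n) (of_real x)))"
  by (intro summable_q_series_term linearly_bounded_offset linearly_bounded_al_salam_chihara assms)

section \<open>The recurrence of the shifted series in the shift\<close>

locale al_salam_chihara_series =
  fixes q x t :: real and a b :: "'a::{real_normed_field, banach}"
  assumes q: "\<bar>q\<bar> < 1" and x: "\<bar>x\<bar> \<le> 1" and t: "\<bar>t\<bar> < 1"
begin

abbreviation Q :: "nat \<Rightarrow> 'a" where
  "Q i \<equiv> al_salam_chihara a b (of_real q) i (of_real x)"

abbreviation F :: "nat \<Rightarrow> 'a" where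
  "F n \<equiv> q_series q t (\<lambda>i. Q (i + n))"

abbreviation q' :: 'a where "q' \<equiv> of_real q"
abbreviation t' :: 'a where "t' \<equiv> of_real t"
abbreviation x' :: 'a where "x' \<equiv> of_real x"

lemma bounded_Q: "linearly_bounded (\<lambda>i. Q (i + n))"
  using linearly_bounded_offset[OF linearly_bounded_al_salam_chihara[OF x q]] .

lemma bounded_cmult:
  assumes "linearly_bounded u"
  shows "linearly_bounded (\<lambda>i. c * u i :: 'a)"
  by (rule linearly_bounded_mult[OF assms, of _ "norm c"]) simp

lemma bounded_power: "linearly_bounded u \<Longrightarrow> linearly_bounded (\<lambda>i. q' ^ i * u i)"
  using q by (intro linearly_bounded_power_mult) auto

lemma q_series_power_Q: "q_series q t (\<lambda>i. q' ^ i * Q (i + n)) = F n - t' * F (Suc n)"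
  using q_series_power_mult[OF q t bounded_Q] by simp

text \<open>The second application shifts \<open>q^i\<close> to \<open>q^(i+1)\<close> as well,
  whence the factor \<open>q'\<close>.\<close>

lemma q_series_power_power_Q:
  "q_series q t (\<lambda>i. q' ^ i * (q' ^ i * Q (i + n)))
    = F n - t' * F (Suc n) - t' * q' * (F (Suc n) - t' * F (Suc (Suc n)))"
proof -
  have "q_series q t (\<lambda>i. q' ^ i * (q' ^ i * Q (i + n)))
      = F n - t' * F (Suc n) - t' * q_series q t (\<lambda>i. q' * (q' ^ i * Q (i + Suc n)))"
    using q_series_power_mult[OF q t bounded_power[OF bounded_Q[of n]]]
    unfolding q_series_power_Q by (simp add: mult.assoc)
  then show ?thesis
    unfolding q_series_cmult[OF q t bounded_power[OF bounded_Q]] q_series_power_Q by (simp add: mult.assoc)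
qed

text \<open>The factor \<open>1 - q^i\<close> in front of the polynomial of index
  \<open>i - 1\<close> absorbs that backward shift: its series is again one over index
  \<open>i\<close>, so no third unknown appears.\<close>

lemma F_1:
  "(1 - a * t') * (1 - b * t') * F 1 = (2 * x' - cdq_hahn_d a b t' q' 0) * F 0"
proof -
  \<comment> \<open>For \<open>i > 0\<close> this is \<open>(1 - a b q^(i-1))\<close> times the
    polynomial of index \<open>i - 1\<close>. The value at 0 is multiplied by
    \<open>1 - q^0 = 0\<close>; the case split avoids negative powers of \<open>q\<close>.\<close>
  define v where "v i = (case i of 0 \<Rightarrow> 0 | Suc j \<Rightarrow> Q j + (- (a * b)) * (q' ^ j * Q j))" for i
  have v_Suc: "linearly_bounded (\<lambda>i. v (Suc i))"
    unfolding v_def nat.case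
    using bounded_Q[of 0] by (intro linearly_bounded_add bounded_cmult bounded_power) simp_all
  have v: "linearly_bounded v"
  proof -
    obtain C where C: "C \<ge> 0" "\<And>n. norm (v (Suc n)) \<le> C * real (Suc n)"
      using v_Suc by (elim linearly_boundedE) blast
    have "norm (v n) \<le> C * real (Suc n)" for n
    proof (cases n)
      case 0
      then show ?thesis using C(1) by (simp add: v_def)
    next
      case (Suc m)
      have "C * real n \<le> C * real (Suc n)" using C(1) by (intro mult_left_mono) auto
      with C(2)[of m] Suc show ?thesis by simp
    qed
    then show ?thesis unfolding linearly_bounded_def by blast
  qed
  have power_norm: "norm (1 - q' ^ i) \<le> 2" for i
    using q by (intro norm_one_minus_power_le) simp
  have rec: "Q (i + 1) = 2 * x' * Q (i + 0) + (- (a + b)) * (q' ^ i * Q (i + 0))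
      + (-1) * ((1 - q' ^ i) * v i)" for i
    by (cases i) (simp_all add: v_def algebra_simps)
  note bnd = bounded_Q[of 0] bounded_power[OF bounded_Q[of 0]]
    linearly_bounded_mult[OF v power_norm]
  have "F 1 = 2 * x' * F 0 + (- (a + b)) * q_series q t (\<lambda>i. q' ^ i * Q (i + 0))
      + (-1) * q_series q t (\<lambda>i. (1 - q' ^ i) * v i)"
    unfolding rec
    by (simp only: q_series_add[OF q t] q_series_cmult[OF q t]
        linearly_bounded_add bounded_cmult bnd)
  also have "q_series q t (\<lambda>i. (1 - q' ^ i) * v i) = t' * q_series q t (\<lambda>i. v (Suc i))"
    by (rule q_series_one_minus_power[OF q t v])
  also have "q_series q t (\<lambda>i. v (Suc i)) = F 0 + (- (a * b)) * q_series q t (\<lambda>i. q' ^ i * Q (i + 0))"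
    unfolding v_def nat.case
    using q_series_add[OF q t bnd(1) bounded_cmult[OF bnd(2), of "- (a * b)"]]
    unfolding q_series_cmult[OF q t bnd(2)] by simp
  finally have "F 1 = 2 * x' * F 0 + (- (a + b)) * (F 0 - t' * F 1)
      + (-1) * (t' * (F 0 + (- (a * b)) * (F 0 - t' * F 1)))"
    unfolding q_series_power_Q by simp
  moreover have "(1 - a * t') * (1 - b * t') * f1 = (2 * x' - cdq_hahn_d a b t' q' 0) * f0"
    if "f1 = 2 * x' * f0 + (- (a + b)) * (f0 - t' * f1)
      + (-1) * (t' * (f0 + (- (a * b)) * (f0 - t' * f1)))" for f0 f1
    unfolding cdq_hahn_d.simps using that by algebra
  ultimately show ?thesis by blast
qed

text \<open>Both the \<open>q^i\<close> and the \<open>q^(2i)\<close> terms produce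
  \<open>F (Suc (Suc m))\<close> again. Moved to the left, they form
  \<open>1 - (a + b) t q^(m+1) + a b t^2 q^(2m+2)\<close>, which factors as displayed.\<close>

lemma F_recurrence:
  "(1 - a * t' * q' ^ Suc m) * (1 - b * t' * q' ^ Suc m) * F (Suc (Suc m))
    = (2 * x' - cdq_hahn_d a b t' q' (Suc m)) * F (Suc m)
      - (1 - a * b * q' ^ m) * (1 - q' ^ Suc m) * F m"
proof -
  let ?p = "q' ^ m"
  have rec: "Q (i + Suc (Suc m)) = 2 * x' * Q (i + Suc m)
      + (- (a + b) * q' * ?p) * (q' ^ i * Q (i + Suc m))
      + (-1) * Q (i + m) + (?p * (q' + a * b)) * (q' ^ i * Q (i + m))
      + (- (a * b) * ?p * ?p * q') * (q' ^ i * (q' ^ i * Q (i + m)))" for i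
    by (simp add: power_add algebra_simps)
  note bnd = bounded_Q[of m] bounded_Q[of "Suc m"] bounded_power[OF bounded_Q[of m]]
    bounded_power[OF bounded_Q[of "Suc m"]] bounded_power[OF bounded_power[OF bounded_Q[of m]]]
  have "F (Suc (Suc m)) = 2 * x' * F (Suc m)
      + (- (a + b) * q' * ?p) * q_series q t (\<lambda>i. q' ^ i * Q (i + Suc m))
      + (-1) * F m + (?p * (q' + a * b)) * q_series q t (\<lambda>i. q' ^ i * Q (i + m))
      + (- (a * b) * ?p * ?p * q') * q_series q t (\<lambda>i. q' ^ i * (q' ^ i * Q (i + m)))"
    unfolding rec
    by (simp only: q_series_add[OF q t] q_series_cmult[OF q t]
        linearly_bounded_add bounded_cmult bnd)
  then have "F (Suc (Suc m)) = 2 * x' * F (Suc m)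
      + (- (a + b) * q' * ?p) * (F (Suc m) - t' * F (Suc (Suc m)))
      + (-1) * F m + (?p * (q' + a * b)) * (F m - t' * F (Suc m))
      + (- (a * b) * ?p * ?p * q')
        * (F m - t' * F (Suc m) - t' * q' * (F (Suc m) - t' * F (Suc (Suc m))))"
    unfolding q_series_power_Q q_series_power_power_Q .
  moreover have "(1 - a * t' * (q' * p)) * (1 - b * t' * (q' * p)) * f2
    = (2 * x' - ((a + b + t') * (q' * p) + a * b * t' * p * (1 - q' * p - q' * (q' * p)))) * f1
      - (1 - a * b * p) * (1 - q' * p) * f0"
    if "f2 = 2 * x' * f1 + (- (a + b) * q' * p) * (f1 - t' * f2)
      + (-1) * f0 + (p * (q' + a * b)) * (f0 - t' * f1)
      + (- (a * b) * p * p * q') * (f0 - t' * f1 - t' * q' * (f1 - t' * f2))" for p f0 f1 f2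
    using that by algebra
  ultimately show ?thesis
    unfolding cdq_hahn_d.simps power_Suc by blast
qed

text \<open>Of the three factors of \<open>cdq_hahn_f\<close>, only \<open>1 - a b q^m\<close> comes
  from the recurrence of \<open>F\<close>; the two with \<open>t\<close> arise in passing from index
  \<open>Suc m\<close> to \<open>m\<close> in the products. Without denominators, no bound on
  \<open>a t\<close> and \<open>b t\<close> is required here.\<close>

lemma F_eq_cdq_hahn:
  "qpoch (a * t') q' n * qpoch (b * t') q' n * F n = cdq_hahn a b t' q' n x' * F 0"
proof (induction n rule: induct_nat_012)
  case 0
  show ?case by (simp add: qpoch_def)
next
  case 1
  show ?case using F_1 by (simp add: qpoch_def)
next
  case (ge2 m)
  let ?A = "\<lambda>k. qpoch (a * t') q' k" and ?B = "\<lambda>k. qpoch (b * t') q' k"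
  have "?A (Suc (Suc m)) * ?B (Suc (Suc m)) * F (Suc (Suc m))
      = ?A (Suc m) * ?B (Suc m)
        * ((1 - a * t' * q' ^ Suc m) * (1 - b * t' * q' ^ Suc m) * F (Suc (Suc m)))"
    unfolding qpoch_Suc[of _ _ "Suc m"] by (simp only: mult_ac)
  also have "\<dots> = (2 * x' - cdq_hahn_d a b t' q' (Suc m)) * (?A (Suc m) * ?B (Suc m) * F (Suc m))
      - (1 - a * b * q' ^ m) * (1 - q' ^ Suc m) * (?A (Suc m) * ?B (Suc m) * F m)"
    unfolding F_recurrence by (simp only: right_diff_distrib mult_ac)
  also have "?A (Suc m) * ?B (Suc m) * F m
      = (1 - a * t' * q' ^ m) * (1 - b * t' * q' ^ m) * (?A m * ?B m * F m)"
    unfolding qpoch_Suc by (simp only: mult_ac)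
  also have "(2 * x' - cdq_hahn_d a b t' q' (Suc m)) * (?A (Suc m) * ?B (Suc m) * F (Suc m))
      - (1 - a * b * q' ^ m) * (1 - q' ^ Suc m)
        * ((1 - a * t' * q' ^ m) * (1 - b * t' * q' ^ m) * (?A m * ?B m * F m))
      = cdq_hahn a b t' q' (Suc (Suc m)) x' * F 0"
    unfolding ge2.IH cdq_hahn.simps cdq_hahn_f_def by (simp add: algebra_simps)
  finally show ?case .
qed

end

section \<open>Nonvanishing of the series\<close>

text \<open>
  Needed for the quotient in the limit $q \to 1$ to be meaningful.
  The series satisfies a first order $q$-difference equation in \<open>t\<close>, so a zero at \<open>t\<close> would
  propagate to all $q^k t$ and, by continuity, to $0$, where the value is $1$.
\<close>

lemma q_series_al_salam_chihara_nonzero: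
  fixes a b :: "'a::{real_normed_field, banach}"
  assumes q: "\<bar>q\<bar> < 1" and x: "\<bar>x\<bar> \<le> 1" and t: "\<bar>t\<bar> < 1"
    and a: "norm (a * of_real t) < 1" and b: "norm (b * of_real t) < 1"
  shows "q_series q t (\<lambda>i. al_salam_chihara a b (of_real q) i (of_real x)) \<noteq> 0"
proof
  let ?Q = "\<lambda>i. al_salam_chihara a b (of_real q) i (of_real x) :: 'a"
  define H where "H s = q_series q s ?Q" for s
  assume "q_series q t ?Q = 0"
  then have 0: "H t = 0" by (simp add: H_def)
  have le: "\<bar>q ^ k * s\<bar> \<le> \<bar>s\<bar>" for k s
    using q by (simp add: abs_mult power_abs mult_left_le_one_le power_le_one)
  have le': "norm (c * of_real (q ^ k * t)) < 1" if "norm (c * of_real t) < 1" for k and c :: 'a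
    using mult_left_mono[OF le[of k t] norm_ge_zero[of c]] that
    unfolding norm_mult norm_of_real by simp
  have zero: "H (q ^ k * t) = 0" for k
  proof (induction k)
    case (Suc k)
    define s where "s = q ^ k * t"
    \<comment> \<open>At the point \<open>s\<close>, \<open>H (q * s)\<close> is
      \<open>F 0 - s * F 1\<close>. \<open>F_1\<close> makes \<open>F 1\<close> a multiple of
      \<open>F 0\<close> once \<open>(1 - a s) (1 - b s)\<close> is nonzero, which follows from
      \<open>\<bar>s\<bar> \<le> \<bar>t\<bar>\<close>.\<close>
    interpret al_salam_chihara_series q x s a b
      using q x t le[of k t] unfolding s_def by unfold_locales auto
    have "1 - c * of_real s \<noteq> (0::'a)" if "norm (c * of_real t) < 1" for c
      using le'[OF that, of k] one_minus_mult_power_nonzero[of "c * of_real s" 1 0]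
      unfolding s_def by simp
    then have "(1 - a * of_real s) * (1 - b * of_real s) \<noteq> 0"
      using a b by simp
    moreover have "F 0 = 0" using Suc.IH by (simp add: H_def s_def)
    ultimately have "F 1 = 0" using F_1 by simp
    then have "H (q * s) = 0"
      unfolding H_def q_series_base_mult using \<open>F 0 = 0\<close> q_series_power_Q[of 0] by simp
    then show ?case by (simp add: s_def mult.assoc)
  qed (use 0 in simp)
  define c where "c i = ?Q i / of_real (qpoch q q i)" for i
  have H_powser: "H s = (\<Sum>i. c i * of_real s ^ i)" for s
    unfolding H_def q_series_def q_series_term_def c_def by (simp add: field_simps)
  \<comment> \<open>Convergence at one point other than 0 suffices for continuity at 0; 1/2 is an
    arbitrary point of (0,1).\<close>
  have "isCont (\<lambda>z. \<Sum>i. c i * z ^ i) (0::'a)"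
  proof (rule isCont_powser)
    show "summable (\<lambda>i. c i * of_real (1/2) ^ i)"
      using summable_al_salam_chihara[OF q x, of "1/2" a b 0] unfolding q_series_term_def c_def by (simp add: field_simps)
  qed simp
  moreover have "(\<lambda>k. of_real (q ^ k * t) :: 'a) \<longlonglongrightarrow> of_real (0 * t)"
    using q by (intro tendsto_of_real tendsto_mult tendsto_const LIMSEQ_power_zero) simp
  ultimately have "(\<lambda>k. H (q ^ k * t)) \<longlonglongrightarrow> (\<Sum>i. c i * 0 ^ i)"
    unfolding H_powser by (intro isCont_tendsto_compose[where g = "\<lambda>z. \<Sum>i. c i * z ^ i"]) auto
  moreover have "(\<Sum>i. c i * 0 ^ i) = 1"
    unfolding powser_zero by (simp add: c_def qpoch_def)
  ultimately show False
    unfolding zero using LIMSEQ_unique[OF tendsto_const] by fastforce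
qed

section \<open>Continuity in the base\<close>

lemma tendsto_qpoch:
  fixes f :: "'b \<Rightarrow> 'a::{real_normed_field}"
  assumes "(f \<longlongrightarrow> l) G"
  shows "((\<lambda>p. qpoch c (f p) n) \<longlongrightarrow> qpoch c l n) G"
  unfolding qpoch_def by (intro tendsto_intros assms)

lemma tendsto_cdq_hahn:
  fixes f :: "'b \<Rightarrow> 'a::{real_normed_field}"
  assumes f: "(f \<longlongrightarrow> l) G"
  shows "((\<lambda>p. cdq_hahn a b c (f p) n y) \<longlongrightarrow> cdq_hahn a b c l n y) G"
proof (induction n rule: induct_nat_012)
  case (ge2 n)
  then show ?case
    unfolding cdq_hahn.simps cdq_hahn_d.simps cdq_hahn_f_def
    by (intro tendsto_intros f)
qed simp_all

section \<open>Specializations, and the shift identity with its limit\<close>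

lemma q_hermite_eq_big: "q_hermite q n x = big_q_hermite 0 q n x"
  by (induction n rule: induct_nat_012) simp_all

lemma big_q_hermite_eq_al_salam_chihara: "big_q_hermite a q n x = al_salam_chihara a 0 q n x"
  by (induction n rule: induct_nat_012) simp_all

text \<open>For (ii): \<open>b = 0\<close> occupies the second slot, and \<open>t\<close> takes the
  third.\<close>

lemma cdq_hahn_zero: "cdq_hahn a 0 c q n x = al_salam_chihara a c q n x"
  by (induction n rule: induct_nat_012) (simp_all add: cdq_hahn_f_def)

lemma cdq_hahn_zero_zero: "cdq_hahn 0 0 c q n x = big_q_hermite c q n x"
  by (induction n rule: induct_nat_012) (simp_all add: cdq_hahn_f_def)

lemma qpoch_zero: "qpoch 0 q n = 1"
  by (simp add: qpoch_def)

lemma al_salam_chihara_shift: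
  fixes a b :: "'a::{real_normed_field, banach}"
  assumes q: "\<bar>q\<bar> < 1" and x: "\<bar>x\<bar> \<le> 1" and t: "\<bar>t\<bar> < 1"
    and a: "norm (a * of_real t) < 1" and b: "norm (b * of_real t) < 1"
  shows "q_series q t (\<lambda>i. al_salam_chihara a b (of_real q) (i + n) (of_real x))
            = cdq_hahn a b (of_real t) (of_real q) n (of_real x)
                / (qpoch (a * of_real t) (of_real q) n * qpoch (b * of_real t) (of_real q) n)
              * q_series q t (\<lambda>i. al_salam_chihara a b (of_real q) i (of_real x))"
proof -
  interpret al_salam_chihara_series q x t a b
    using q x t by unfold_locales
  have "qpoch (a * t') q' n \<noteq> 0" "qpoch (b * t') q' n \<noteq> 0"
    using a b q by (simp_all add: qpoch_nonzero)
  with F_eq_cdq_hahn[of n] show ?thesis by (simp add: field_simps)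
qed

text \<open>For bases in (0,1) the series without shift is nonzero and cancels, so the quotient is a
  rational function of the base. Its denominator at 1 is a product of powers of
  \<open>1 - a t\<close> and \<open>1 - b t\<close>, which are nonzero.\<close>

lemma al_salam_chihara_shift_tendsto:
  fixes a b :: "'a::{real_normed_field, banach}"
  assumes x: "\<bar>x\<bar> \<le> 1" and t: "\<bar>t\<bar> < 1"
    and a: "norm (a * of_real t) < 1" and b: "norm (b * of_real t) < 1"
  shows "((\<lambda>p. q_series p t (\<lambda>i. al_salam_chihara a b (of_real p) (i + n) (of_real x))
                 / q_series p t (\<lambda>i. al_salam_chihara a b (of_real p) i (of_real x)))
             \<longlongrightarrow> cdq_hahn a b (of_real t) 1 n (of_real x)
                   / (qpoch (a * of_real t) 1 n * qpoch (b * of_real t) 1 n))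
            (at_left 1)"
proof -
  have lim: "((\<lambda>p. of_real p :: 'a) \<longlongrightarrow> 1) (at_left 1)"
    by (rule tendsto_eq_intros refl | simp)+
  have "((\<lambda>p. cdq_hahn a b (of_real t) (of_real p) n (of_real x)
                / (qpoch (a * of_real t) (of_real p) n * qpoch (b * of_real t) (of_real p) n))
             \<longlongrightarrow> cdq_hahn a b (of_real t) 1 n (of_real x)
                   / (qpoch (a * of_real t) 1 n * qpoch (b * of_real t) 1 n)) (at_left 1)"
    by (intro tendsto_divide tendsto_mult tendsto_qpoch tendsto_cdq_hahn lim)
      (use a b in \<open>simp add: qpoch_nonzero\<close>)
  moreover have "\<forall>\<^sub>F p in at_left 1. p \<in> {0<..<1::real}"
    by (rule eventually_at_left_real) simp
  then have "\<forall>\<^sub>F p in at_left 1.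
      cdq_hahn a b (of_real t) (of_real p) n (of_real x)
                / (qpoch (a * of_real t) (of_real p) n * qpoch (b * of_real t) (of_real p) n)
      = q_series p t (\<lambda>i. al_salam_chihara a b (of_real p) (i + n) (of_real x))
                 / q_series p t (\<lambda>i. al_salam_chihara a b (of_real p) i (of_real x))"
  proof eventually_elim
    case (elim p)
    then have "\<bar>p\<bar> < 1" by simp
    from q_series_al_salam_chihara_nonzero[OF this x t a b] show ?case
      unfolding al_salam_chihara_shift[OF \<open>\<bar>p\<bar> < 1\<close> x t a b] by simp
  qed
  ultimately show ?thesis
    by (rule Lim_transform_eventually)
qed

theorem theorem1:
  fixes q x t :: real
    and a b :: "'a::{real_normed_field, banach}"
    and n :: nat
  assumes "-1 < q" and "q \<le> 1"
  shows
    "(x\<^sup>2 \<le> 1 \<longrightarrow> t\<^sup>2 < 1 \<longrightarrow>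
       (q < 1 \<longrightarrow>
          summable (q_series_term q t (\<lambda>i. q_hermite q (i + n) x)) \<and>
          summable (q_series_term q t (\<lambda>i. q_hermite q i x)) \<and>
          q_series q t (\<lambda>i. q_hermite q (i + n) x)
            = big_q_hermite t q n x * q_series q t (\<lambda>i. q_hermite q i x)) \<and>
       (q = 1 \<longrightarrow>
          ((\<lambda>p. q_series p t (\<lambda>i. q_hermite p (i + n) x)
                 / q_series p t (\<lambda>i. q_hermite p i x))
             \<longlongrightarrow> big_q_hermite t q n x) (at_left q)))
     \<and>
     (x\<^sup>2 \<le> 1 \<longrightarrow> t\<^sup>2 < 1 \<longrightarrow> norm (a * of_real t) < 1 \<longrightarrow>
       (q < 1 \<longrightarrow>
          summable (q_series_term q t (\<lambda>i. big_q_hermite a (of_real q) (i + n) (of_real x))) \<and>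
          summable (q_series_term q t (\<lambda>i. big_q_hermite a (of_real q) i (of_real x))) \<and>
          q_series q t (\<lambda>i. big_q_hermite a (of_real q) (i + n) (of_real x))
            = al_salam_chihara a (of_real t) (of_real q) n (of_real x)
                / qpoch (a * of_real t) (of_real q) n
              * q_series q t (\<lambda>i. big_q_hermite a (of_real q) i (of_real x))) \<and>
       (q = 1 \<longrightarrow>
          ((\<lambda>p. q_series p t (\<lambda>i. big_q_hermite a (of_real p) (i + n) (of_real x))
                 / q_series p t (\<lambda>i. big_q_hermite a (of_real p) i (of_real x)))
             \<longlongrightarrow> al_salam_chihara a (of_real t) (of_real q) n (of_real x)
                   / qpoch (a * of_real t) (of_real q) n) (at_left q)))
     \<and>
     (\<bar>x\<bar> \<le> 1 \<longrightarrow> t\<^sup>2 < 1 \<longrightarrow> norm (a * of_real t) < 1 \<longrightarrow> norm (b * of_real t) < 1 \<longrightarrow>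
       (q < 1 \<longrightarrow>
          summable (q_series_term q t (\<lambda>i. al_salam_chihara a b (of_real q) (i + n) (of_real x))) \<and>
          summable (q_series_term q t (\<lambda>i. al_salam_chihara a b (of_real q) i (of_real x))) \<and>
          q_series q t (\<lambda>i. al_salam_chihara a b (of_real q) (i + n) (of_real x))
            = cdq_hahn a b (of_real t) (of_real q) n (of_real x)
                / (qpoch (a * of_real t) (of_real q) n * qpoch (b * of_real t) (of_real q) n)
              * q_series q t (\<lambda>i. al_salam_chihara a b (of_real q) i (of_real x))) \<and>
       (q = 1 \<longrightarrow>
          ((\<lambda>p. q_series p t (\<lambda>i. al_salam_chihara a b (of_real p) (i + n) (of_real x))
                 / q_series p t (\<lambda>i. al_salam_chihara a b (of_real p) i (of_real x)))
             \<longlongrightarrow> cdq_hahn a b (of_real t) (of_real q) n (of_real x)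
                   / (qpoch (a * of_real t) (of_real q) n * qpoch (b * of_real t) (of_real q) n))
            (at_left q)))"
proof -
  have sq: "\<bar>y\<bar> \<le> 1" if "y\<^sup>2 \<le> 1" for y :: real
    using that by (simp add: abs_square_le_1)
  have sq': "\<bar>y\<bar> < 1" if "y\<^sup>2 < 1" for y :: real
    using that by (simp add: abs_square_less_1)
  have q: "\<bar>q\<bar> < 1" if "q < 1"
    using that assms by simp
  \<comment> \<open>The series in (i) are real, so the zero parameters are taken in type
    \<open>real\<close>, not in the field of \<open>a\<close> and \<open>b\<close>.\<close>
  have shift_i: "q_series q t (\<lambda>i. q_hermite q (i + n) x)
      = big_q_hermite t q n x * q_series q t (\<lambda>i. q_hermite q i x)"
    if "\<bar>x\<bar> \<le> 1" "\<bar>t\<bar> < 1" "q < 1"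
    using al_salam_chihara_shift[OF q[OF that(3)] that(1,2), of "0::real" 0 n]
    unfolding q_hermite_eq_big cdq_hahn_zero_zero big_q_hermite_eq_al_salam_chihara
    by (simp add: qpoch_zero)
  have tendsto_i: "((\<lambda>p. q_series p t (\<lambda>i. q_hermite p (i + n) x)
      / q_series p t (\<lambda>i. q_hermite p i x)) \<longlongrightarrow> big_q_hermite t 1 n x) (at_left 1)"
    if "\<bar>x\<bar> \<le> 1" "\<bar>t\<bar> < 1"
    using al_salam_chihara_shift_tendsto[OF that, of "0::real" 0 n]
    unfolding q_hermite_eq_big cdq_hahn_zero_zero big_q_hermite_eq_al_salam_chihara
    by (simp add: qpoch_zero)
  have shift_ii: "q_series q t (\<lambda>i. big_q_hermite a (of_real q) (i + n) (of_real x))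
      = al_salam_chihara a (of_real t) (of_real q) n (of_real x) / qpoch (a * of_real t) (of_real q) n
        * q_series q t (\<lambda>i. big_q_hermite a (of_real q) i (of_real x))"
    if "\<bar>x\<bar> \<le> 1" "\<bar>t\<bar> < 1" "norm (a * of_real t) < 1" "q < 1"
    using al_salam_chihara_shift[OF q[OF that(4)] that(1-3), of 0 n]
    unfolding cdq_hahn_zero big_q_hermite_eq_al_salam_chihara
    by (simp add: qpoch_zero)
  have tendsto_ii: "((\<lambda>p. q_series p t (\<lambda>i. big_q_hermite a (of_real p) (i + n) (of_real x))
      / q_series p t (\<lambda>i. big_q_hermite a (of_real p) i (of_real x)))
      \<longlongrightarrow> al_salam_chihara a (of_real t) 1 n (of_real x) / qpoch (a * of_real t) 1 n) (at_left 1)"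
    if "\<bar>x\<bar> \<le> 1" "\<bar>t\<bar> < 1" "norm (a * of_real t) < 1"
    using al_salam_chihara_shift_tendsto[OF that, of 0 n]
    unfolding cdq_hahn_zero big_q_hermite_eq_al_salam_chihara
    by (simp add: qpoch_zero)
  have summable_i: "summable (q_series_term q t (\<lambda>i. q_hermite q (i + m) x))"
    if "\<bar>x\<bar> \<le> 1" "\<bar>t\<bar> < 1" "q < 1" for m
    using summable_al_salam_chihara[OF q[OF that(3)] that(1,2), of "0::real" 0 m]
    unfolding q_hermite_eq_big big_q_hermite_eq_al_salam_chihara by simp
  have summable_ii: "summable (q_series_term q t (\<lambda>i. big_q_hermite a (of_real q) (i + m) (of_real x)))"
    if "\<bar>x\<bar> \<le> 1" "\<bar>t\<bar> < 1" "q < 1" for m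
    unfolding big_q_hermite_eq_al_salam_chihara
    by (rule summable_al_salam_chihara[OF q[OF that(3)] that(1,2)])
  show ?thesis
    using shift_i tendsto_i summable_i[of n] summable_i[of 0]
      shift_ii tendsto_ii summable_ii[of n] summable_ii[of 0]
      al_salam_chihara_shift[OF q, of x t a b n] al_salam_chihara_shift_tendsto[of x t a b n]
      summable_al_salam_chihara[OF q, of x t a b n] summable_al_salam_chihara[OF q, of x t a b 0]
    unfolding add_0_right
    by (intro conjI impI) (simp_all only: sq sq' of_real_1)
qed

end
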